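(* Let $\mathcal E$ be a finite-dimensional real inner product space, let $F\colon\mathcal E\to\mathcal E$ be locally Lipschitz continuous and monotone, let $g\colon\mathcal E\to(-\infty,+\infty]$ be a proper lower semicontinuous convex function whose restriction $g|_{\operatorname{dom} g}$ is continuous, and suppose that the solution set $X^*$ of the problem: find $x^*\in\mathcal E$ with $\langle F(x^* ),x-x^*\rangle+g(x)-g(x^* )\ge 0$ for all $x\in\mathcal E$, is nonempty. Let the sequences $(x_n)$ and $(y_n)$ be generated either by Algorithm 1 (in the case $g=\delta_C$ with $C\subseteq\mathcal E$ nonempty, closed and convex) or by Algorithm 2, both described in the context. Then $(x_n)$ and $(y_n)$ converge to a solution, i.e. there is $x^*\in X^*$ with $x_n\to x^*$ and $y_n\to x^*$.
   Context: Notation: $\operatorname{dom} g=\{x: g(x)<\infty\}$; $\delta_C$ is the indicator function of $C$ ($0$ on $C$, $+\infty$ outside); $\operatorname{prox}_{g}(y)=\operatorname{argmin}_{x}\{g(x)+\frac12\|x-y\|^2\}$; $P_C=\operatorname{prox}_{\delta_C}$ is the metric projection onto $C$. $F$ is monotone if $\langle F(x)-F(y),x-y\rangle\ge0$ for all $x,y$. Algorithm 1 (for $g=\delta_C$). Initialization: $\alpha\in(0,\sqrt2-1)$, $\lambda_{max}>0$, $\sigma\in(0,1)$, $x_1,x_0,y_0\in\mathcal E$, $\lambda_0>0$, $\tau_0=1$. Iteration $n\ge1$: given $x_n,x_{n-1},y_{n-1},\lambda_{n-1},\tau_{n-1}$, run the linesearch: for $i=0,1,2,\dots$ set $\tau_n=\sigma^i$,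 $y_n=x_n+\tau_n(x_n-x_{n-1})$, and let $\lambda_n$ be the largest number in $\bigl(0,\min\{\frac{1+\tau_{n-1}}{\tau_n}\lambda_{n-1},\lambda_{max}\}\bigr]$ such that $$\|\lambda_nF(y_n)-\lambda_{n-1}\tau_nF(y_{n-1})\|\le\alpha\|y_n-y_{n-1}\|,$$ stopping the linesearch at the first $i$ for which such $\lambda_n$ exists. Then set $x_{n+1}=P_C(x_n-\lambda_nF(y_n))$. Algorithm 2. Initialization: $\alpha\in(0,\sqrt2-1)$, $\lambda_{max}>0$, $\sigma\in(0,1)$, $x_1,x_0,y_0\in\mathcal E$, $\lambda_0>0$, $\tau_0=1$. Iteration $n\ge1$: given $x_n,x_{n-1},y_{n-1},\lambda_{n-1},\tau_{n-1}$, run the linesearch: for $i=0,1,2,\dots$ set $\tau_n=\sqrt{1+\tau_{n-1}}\,\sigma^i$ if $\lambda_{n-1}\le\frac12\lambda_{max}$ and $\tau_n=\sigma^i$ otherwise, $y_n=x_n+\tau_n(x_n-x_{n-1})$, $\lambda_n=\tau_n\lambda_{n-1}$, stopping at the first $i$ for which $$\lambda_n\|F(y_n)-F(y_{n-1})\|\le\alpha\|y_n-y_{n-1}\|.$$ Then set $x_{n+1}=\operatorname{prox}_{\lambda_ng}(x_n-\lambda_nF(y_n))$. In both algorithms the linesearch always terminates after finitely many $i$. *)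

theory Defs
  imports "HOL-Analysis.Analysis"
begin

text \<open>The set-valued parameters of \<^const>\<open>local_lipschitz\<close> are a time domain and a space domain;
  an autonomous map is constant in time.\<close>

definition locally_lipschitz :: "('a::metric_space \<Rightarrow> 'b::metric_space) \<Rightarrow> bool" where
  "locally_lipschitz F \<longleftrightarrow> local_lipschitz (UNIV :: real set) UNIV (\<lambda>_. F)"

definition monotone_operator :: "('a::real_inner \<Rightarrow> 'a) \<Rightarrow> bool" where
  "monotone_operator F \<longleftrightarrow> (\<forall>x y. (F x - F y) \<bullet> (x - y) \<ge> 0)"

definition edom :: "('a \<Rightarrow> ereal) \<Rightarrow> 'a set" where
  "edom g = {x. g x < \<infinity>}"

definition proper_fun :: "('a \<Rightarrow> ereal) \<Rightarrow> bool" where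
  "proper_fun g \<longleftrightarrow> (\<forall>x. g x \<noteq> -\<infinity>) \<and> edom g \<noteq> {}"

definition lsc_fun :: "('a::topological_space \<Rightarrow> ereal) \<Rightarrow> bool" where
  "lsc_fun g \<longleftrightarrow> (\<forall>x. g x \<le> Liminf (at x) g)"

definition convex_fun :: "('a::real_vector \<Rightarrow> ereal) \<Rightarrow> bool" where
  "convex_fun g \<longleftrightarrow>
     (\<forall>x y. \<forall>t\<in>{0<..<1}.
        g ((1 - t) *\<^sub>R x + t *\<^sub>R y) \<le> ereal (1 - t) * g x + ereal t * g y)"

text \<open>The indicator function in the sense of convex analysis, not the library's
  0/1-valued \<^const>\<open>indicator\<close>.\<close>

definition delta :: "'a set \<Rightarrow> 'a \<Rightarrow> ereal" where
  "delta C x = (if x \<in> C then 0 else \<infinity>)"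

text \<open>For proper, lower semicontinuous, convex \<open>g\<close> the minimizer exists and is unique, so the
  choice made by \<^const>\<open>arg_min\<close> is immaterial.\<close>

definition prox :: "('a::real_inner \<Rightarrow> ereal) \<Rightarrow> 'a \<Rightarrow> 'a" where
  "prox g y = (ARG_MIN (\<lambda>x. g x + ereal (1 / 2 * (norm (x - y))\<^sup>2)) x. True)"

definition proj :: "'a::real_inner set \<Rightarrow> 'a \<Rightarrow> 'a" where
  "proj C = prox (delta C)"

text \<open>If \<open>g\<close> is proper, every solution lies in \<^term>\<open>edom g\<close>: in \<^typ>\<open>ereal\<close> one has \<open>r - \<infinity> = -\<infinity>\<close>
  for real \<open>r\<close>, so a point with \<open>g xs = \<infinity>\<close> violates the inequality at any \<open>x\<close> in \<^term>\<open>edom g\<close>.\<close>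

definition solutions :: "('a::real_inner \<Rightarrow> 'a) \<Rightarrow> ('a \<Rightarrow> ereal) \<Rightarrow> 'a set" where
  "solutions F g = {xs. \<forall>x. ereal (F xs \<bullet> (x - xs)) + g x - g xs \<ge> 0}"

definition extrapolate :: "'a::real_vector \<Rightarrow> 'a \<Rightarrow> real \<Rightarrow> 'a" where
  "extrapolate x xp t = x + t *\<^sub>R (x - xp)"

text \<open>In the linesearch definitions below, \<open>x\<close> is the current iterate, and \<open>xp\<close>, \<open>yp\<close>, \<open>lp\<close>, \<open>tp\<close> are the
  previous values of \<open>x\<close>, \<open>y\<close>, \<open>lam\<close>, \<open>\<tau>\<close>. The set \<open>steps1\<close> collects the admissible step sizes for
  a trial value \<open>t\<close> of \<open>\<tau>\<close>.\<close>

definition steps1 ::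
  "('a::real_inner \<Rightarrow> 'a) \<Rightarrow> real \<Rightarrow> real \<Rightarrow> 'a \<Rightarrow> 'a \<Rightarrow> 'a \<Rightarrow> real \<Rightarrow> real \<Rightarrow> real \<Rightarrow> real set" where
  "steps1 F \<alpha> lmax x xp yp lp tp t =
     {l \<in> {0<..min ((1 + tp) / t * lp) lmax}.
        norm (l *\<^sub>R F (extrapolate x xp t) - (lp * t) *\<^sub>R F yp)
          \<le> \<alpha> * norm (extrapolate x xp t - yp)}"

definition is_largest :: "real set \<Rightarrow> real \<Rightarrow> bool" where
  "is_largest S l \<longleftrightarrow> l \<in> S \<and> (\<forall>m\<in>S. m \<le> l)"

definition linesearch1 ::
  "('a::real_inner \<Rightarrow> 'a) \<Rightarrow> real \<Rightarrow> real \<Rightarrow> real \<Rightarrow> 'a \<Rightarrow> 'a \<Rightarrow> 'a \<Rightarrow> real \<Rightarrow> real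
     \<Rightarrow> real \<Rightarrow> 'a \<Rightarrow> real \<Rightarrow> bool" where
  "linesearch1 F \<alpha> lmax \<sigma> x xp yp lp tp t y l \<longleftrightarrow>
     (\<exists>i::nat.
        (\<forall>j<i. \<not> (\<exists>m. is_largest (steps1 F \<alpha> lmax x xp yp lp tp (\<sigma> ^ j)) m)) \<and>
        t = \<sigma> ^ i \<and>
        y = extrapolate x xp t \<and>
        is_largest (steps1 F \<alpha> lmax x xp yp lp tp t) l)"

definition trial2 :: "real \<Rightarrow> real \<Rightarrow> real \<Rightarrow> real \<Rightarrow> nat \<Rightarrow> real" where
  "trial2 lmax \<sigma> lp tp i = (if lp \<le> lmax / 2 then sqrt (1 + tp) * \<sigma> ^ i else \<sigma> ^ i)"

definition accept2 ::
  "('a::real_inner \<Rightarrow> 'a) \<Rightarrow> real \<Rightarrow> 'a \<Rightarrow> 'a \<Rightarrow> 'a \<Rightarrow> real \<Rightarrow> real \<Rightarrow> bool" where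
  "accept2 F \<alpha> x xp yp lp t \<longleftrightarrow>
     t * lp * norm (F (extrapolate x xp t) - F yp) \<le> \<alpha> * norm (extrapolate x xp t - yp)"

definition linesearch2 ::
  "('a::real_inner \<Rightarrow> 'a) \<Rightarrow> real \<Rightarrow> real \<Rightarrow> real \<Rightarrow> 'a \<Rightarrow> 'a \<Rightarrow> 'a \<Rightarrow> real \<Rightarrow> real
     \<Rightarrow> real \<Rightarrow> 'a \<Rightarrow> real \<Rightarrow> bool" where
  "linesearch2 F \<alpha> lmax \<sigma> x xp yp lp tp t y l \<longleftrightarrow>
     (\<exists>i::nat.
        (\<forall>j<i. \<not> accept2 F \<alpha> x xp yp lp (trial2 lmax \<sigma> lp tp j)) \<and>
        t = trial2 lmax \<sigma> lp tp i \<and>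
        y = extrapolate x xp t \<and>
        l = t * lp \<and>
        accept2 F \<alpha> x xp yp lp t)"

definition initialization ::
  "real \<Rightarrow> real \<Rightarrow> real \<Rightarrow> (nat \<Rightarrow> real) \<Rightarrow> (nat \<Rightarrow> real) \<Rightarrow> bool" where
  "initialization \<alpha> lmax \<sigma> lam \<tau> \<longleftrightarrow>
     \<alpha> \<in> {0<..<sqrt 2 - 1} \<and> lmax > 0 \<and> \<sigma> \<in> {0<..<1} \<and> lam 0 > 0 \<and> \<tau> 0 = 1"

text \<open>The starting points \<open>x 0\<close>, \<open>x 1\<close> and \<open>y 0\<close> are unconstrained.\<close>

definition algorithm1 ::
  "('a::real_inner \<Rightarrow> 'a) \<Rightarrow> 'a set \<Rightarrow> real \<Rightarrow> real \<Rightarrow> real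
     \<Rightarrow> (nat \<Rightarrow> 'a) \<Rightarrow> (nat \<Rightarrow> 'a) \<Rightarrow> (nat \<Rightarrow> real) \<Rightarrow> (nat \<Rightarrow> real) \<Rightarrow> bool" where
  "algorithm1 F C \<alpha> lmax \<sigma> x y lam \<tau> \<longleftrightarrow>
     initialization \<alpha> lmax \<sigma> lam \<tau> \<and>
     (\<forall>n\<ge>1.
        linesearch1 F \<alpha> lmax \<sigma> (x n) (x (n - 1)) (y (n - 1)) (lam (n - 1)) (\<tau> (n - 1))
          (\<tau> n) (y n) (lam n) \<and>
        x (n + 1) = proj C (x n - lam n *\<^sub>R F (y n)))"

definition algorithm2 ::
  "('a::real_inner \<Rightarrow> 'a) \<Rightarrow> ('a \<Rightarrow> ereal) \<Rightarrow> real \<Rightarrow> real \<Rightarrow> real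
     \<Rightarrow> (nat \<Rightarrow> 'a) \<Rightarrow> (nat \<Rightarrow> 'a) \<Rightarrow> (nat \<Rightarrow> real) \<Rightarrow> (nat \<Rightarrow> real) \<Rightarrow> bool" where
  "algorithm2 F g \<alpha> lmax \<sigma> x y lam \<tau> \<longleftrightarrow>
     initialization \<alpha> lmax \<sigma> lam \<tau> \<and>
     (\<forall>n\<ge>1.
        linesearch2 F \<alpha> lmax \<sigma> (x n) (x (n - 1)) (y (n - 1)) (lam (n - 1)) (\<tau> (n - 1))
          (\<tau> n) (y n) (lam n) \<and>
        x (n + 1) = prox (\<lambda>u. ereal (lam n) * g u) (x n - lam n *\<^sub>R F (y n)))"

end

theory Submission
  imports Defs
begin

text \<open>
  Both algorithms satisfy the same energy inequality: for a solution \<open>s\<close> and the gap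
  \<open>\<Phi>(z) = F s \<bullet> (z - s) + g z - g s \<ge> 0\<close>, the quantity
  \<open>\<parallel>x\<^sub>n\<^sub>+\<^sub>1 - s\<parallel>\<^sup>2 + 2 \<lambda>\<^sub>n (1 + \<tau>\<^sub>n) \<Phi>(x\<^sub>n) + \<alpha> \<parallel>x\<^sub>n\<^sub>+\<^sub>1 - y\<^sub>n\<parallel>\<^sup>2\<close>
  decreases by at least a multiple of \<open>\<parallel>y\<^sub>n - x\<^sub>n\<parallel>\<^sup>2 + \<parallel>x\<^sub>n\<^sub>+\<^sub>1 - y\<^sub>n\<parallel>\<^sup>2\<close>. The iterates are therefore
  bounded, and \<open>F\<close> is Lipschitz on a ball containing all trial points. Consequently a step size
  below some threshold is never decreased, so along some subsequence the step sizes stay away from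
  zero. A cluster point of that subsequence is a solution, and its own energy tends to zero along
  the subsequence, hence along the whole sequence.
\<close>

subsection \<open>Proximal steps\<close>

text \<open>\<open>Liminf (at x)\<close> ignores the value at \<open>x\<close>; the hypothesis
  \<open>r < g x\<close> supplies it, so the neighbourhood need not be punctured.\<close>

lemma lsc_fun_eventually:
  assumes "lsc_fun g" "r < g x"
  shows "\<forall>\<^sub>F z in nhds x. r < g z"
proof -
  have "r < Liminf (at x) g"
    using assms unfolding lsc_fun_def by (meson less_le_trans)
  then show ?thesis
    using assms(2) less_LiminfD[of r "at x" g] by (simp add: eventually_nhds_conv_at)
qed

text \<open>Without a minimizer, the open sets \<open>{x. f y < f x}\<close> with \<open>y\<close>
  in \<open>K\<close> would cover \<open>K\<close>. In a finite subcover, the centre with the least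
  value is covered by none of them.\<close>

lemma compact_attains_min_lsc:
  fixes f :: "'a::topological_space \<Rightarrow> 'b::linorder"
  assumes "compact K" "K \<noteq> {}"
    and lsc: "\<And>x r. r < f x \<Longrightarrow> \<forall>\<^sub>F z in nhds x. r < f z"
  shows "\<exists>x\<in>K. \<forall>z\<in>K. f x \<le> f z"
proof (rule ccontr)
  assume neg: "\<not> ?thesis"
  have "open {x. r < f x}" for r
    by (subst open_subopen) (use lsc in \<open>fastforce simp: eventually_nhds\<close>)
  moreover have "K \<subseteq> (\<Union>y\<in>K. {x. f y < f x})"
    using neg by (fastforce simp: not_le)
  ultimately obtain Y where Y: "Y \<subseteq> K" "finite Y" "K \<subseteq> (\<Union>y\<in>Y. {x. f y < f x})"
    using compactE_image[OF assms(1), of K "\<lambda>y. {x. f y < f x}"] by metis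
  then have "Y \<noteq> {}"
    using assms(2) by auto
  then have "Min (f ` Y) \<in> f ` Y"
    using Y(2) by (intro Min_in) auto
  then obtain y where "y \<in> Y" "f y = Min (f ` Y)"
    by auto
  with Y(2) have "\<forall>z\<in>Y. f y \<le> f z"
    by auto
  moreover obtain z where "z \<in> Y" "f z < f y"
    using \<open>y \<in> Y\<close> Y by blast
  ultimately show False
    by (auto simp: not_le)
qed

text \<open>A real \<open>m\<close> strictly between \<open>r - q x\<close> and \<open>G x\<close>
  splits the bound: \<open>G\<close> stays above \<open>m\<close> and \<open>m + q\<close> stays
  above \<open>r\<close>, so infinite values cause no trouble.\<close>

lemma lsc_add_continuous:
  fixes G :: "'a::t2_space \<Rightarrow> ereal" and q :: "'a \<Rightarrow> real"
  assumes "lsc_fun G" "continuous_on UNIV q" "r < G x + ereal (q x)"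
  shows "\<forall>\<^sub>F z in nhds x. r < G z + ereal (q z)"
proof -
  have "r - ereal (q x) < G x"
    using assms(3) by (cases r; cases "G x") auto
  then obtain m where m: "r - ereal (q x) < ereal m" "ereal m < G x"
    using ereal_dense2 by blast
  have "(q \<longlongrightarrow> q x) (nhds x)"
    using assms(2) continuous_on_eq_continuous_at[OF open_UNIV, of q]
    by (simp add: isCont_def flip: tendsto_at_iff_tendsto_nhds)
  then have "((\<lambda>z. ereal (m + q z)) \<longlongrightarrow> ereal (m + q x)) (nhds x)"
    by (intro tendsto_intros)
  moreover have "r < ereal (m + q x)"
    using m(1) by (cases r) auto
  ultimately have "\<forall>\<^sub>F z in nhds x. r < ereal (m + q z)"
    by (rule order_tendstoD)
  moreover have "\<forall>\<^sub>F z in nhds x. ereal m < G z"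
    using lsc_fun_eventually[OF assms(1) m(2)] .
  ultimately show ?thesis
  proof eventually_elim
    case (elim z)
    then have "ereal (m + q z) \<le> G z + ereal (q z)"
      by (cases "G z") auto
    with elim show ?case by (meson less_le_trans)
  qed
qed

text \<open>The quadratic outgrows the affine minorant, so a minimizer over a large ball is global.
  Once some minimizer exists, the one chosen by \<open>ARG_MIN\<close> is a minimizer too.\<close>

lemma prox_minimizes:
  fixes G :: "'a::euclidean_space \<Rightarrow> ereal"
  assumes "proper_fun G" "lsc_fun G"
    and minorant: "\<And>z. ereal (c + v \<bullet> z) \<le> G z"
  shows "G (prox G u) + ereal (1 / 2 * (norm (prox G u - u))\<^sup>2)
           \<le> G z + ereal (1 / 2 * (norm (z - u))\<^sup>2)"
proof -
  define h where "h = (\<lambda>z. G z + ereal (1 / 2 * (norm (z - u))\<^sup>2))"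
  obtain x0 where "G x0 < \<infinity>" and "G x0 \<noteq> -\<infinity>"
    using assms(1) by (auto simp: proper_fun_def edom_def)
  then obtain g0 where g0: "G x0 = ereal g0"
    by (cases "G x0") auto
  define H where "H = g0 + 1 / 2 * (norm (x0 - u))\<^sup>2"
  have H: "h x0 = ereal H"
    by (simp add: h_def H_def g0)
  define e where "e = H - c - v \<bullet> u"
  \<comment> \<open>With \<open>d = norm (z - u) > R\<close>, the first terms give
    \<open>d / 2 - norm v >= 1 / 2\<close> and \<open>d / 2 >= e\<close>, hence
    \<open>d * (d / 2 - norm v) >= e\<close>. The last term places \<open>x0\<close> in the
    ball.\<close>
  define R where "R = 2 * norm v + 1 + 2 * \<bar>e\<bar> + norm (x0 - u)"
  have R: "2 * norm v + 1 \<le> R" "2 * e \<le> R"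
    using norm_ge_zero[of v] norm_ge_zero[of "x0 - u"] abs_ge_self[of e] abs_ge_zero[of e]
    unfolding R_def by (linarith, linarith)
  have far: "h x0 \<le> h z" if "norm (z - u) > R" for z
  proof -
    let ?d = "norm (z - u)"
    have "v \<bullet> (z - u) \<ge> - (norm v * ?d)"
      using Cauchy_Schwarz_ineq2[of v "z - u"] by linarith
    moreover have "?d / 2 - norm v \<ge> 1 / 2"
      using that R by linarith
    then have "?d * (?d / 2 - norm v) \<ge> ?d * (1 / 2)"
      by (intro mult_left_mono) auto
    moreover have "?d * (1 / 2) \<ge> e"
      using that R by linarith
    ultimately have "H \<le> c + v \<bullet> z + 1 / 2 * ?d\<^sup>2"
      unfolding e_def by (simp add: algebra_simps power2_eq_square)
    also have "ereal \<dots> \<le> h z"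
      using add_right_mono[OF minorant[of z], of "ereal (1 / 2 * ?d\<^sup>2)"] by (simp add: h_def)
    finally show ?thesis by (simp add: H)
  qed
  have R0: "R \<ge> 0" by (simp add: R_def)
  have "\<exists>p\<in>cball u R. \<forall>z\<in>cball u R. h p \<le> h z"
  proof (rule compact_attains_min_lsc)
    show "\<forall>\<^sub>F z in nhds x. r < h z" if "r < h x" for r x
      using that unfolding h_def
      by (intro lsc_add_continuous assms) (auto intro!: continuous_intros)
  qed (use R0 in auto)
  then obtain p where "\<forall>z\<in>cball u R. h p \<le> h z"
    by blast
  then have p: "h p \<le> h z" if "norm (z - u) \<le> R" for z
    using that by (simp add: dist_norm norm_minus_commute)
  have "h p \<le> h x0"
    by (intro p) (simp add: R_def)
  then have "\<forall>z. h p \<le> h z"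
    using p far by (meson le_less_linear order_trans)
  then have "is_arg_min h (\<lambda>_. True) p"
    by (simp add: is_arg_min_linorder)
  then have "is_arg_min h (\<lambda>_. True) (arg_min h (\<lambda>_. True))"
    unfolding arg_min_def by (rule someI)
  then show ?thesis
    by (simp add: is_arg_min_linorder prox_def h_def)
qed

lemma nonneg_if_perturbation_nonneg:
  fixes a b :: real
  assumes "\<And>t. 0 < t \<Longrightarrow> t < 1 \<Longrightarrow> 0 \<le> a + t * b"
  shows "0 \<le> a"
proof -
  have "((\<lambda>t. a + t * b) \<longlongrightarrow> a + 0 * b) (at_right 0)"
    by (intro tendsto_intros)
  moreover have "\<forall>\<^sub>F t in at_right 0. 0 \<le> a + t * b"
    using assms eventually_at_right_real[of 0 1] by (auto elim!: eventually_mono)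
  ultimately show ?thesis
    using tendsto_lowerbound by fastforce
qed

text \<open>Minimality of \<open>p\<close> is tested on the segment from \<open>p\<close> to
  \<open>z\<close>, where convexity bounds \<open>G\<close>. Dividing by \<open>t\<close> and
  letting \<open>t\<close> tend to 0 removes the quadratic remainder.\<close>

lemma minimizer_variational:
  fixes G :: "'a::real_inner \<Rightarrow> ereal"
  assumes "proper_fun G" "convex_fun G"
    and min: "\<And>z. G p + ereal (1 / 2 * (norm (p - u))\<^sup>2) \<le> G z + ereal (1 / 2 * (norm (z - u))\<^sup>2)"
  shows "p \<in> edom G"
    and "z \<in> edom G \<Longrightarrow> real_of_ereal (G p) - real_of_ereal (G z) \<le> (p - u) \<bullet> (z - p)"
proof -
  obtain w where "w \<in> edom G"
    using assms(1) by (auto simp: proper_fun_def)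
  then show pd: "p \<in> edom G"
    using min[of w] by (cases "G p") (auto simp: edom_def)
  assume zd: "z \<in> edom G"
  obtain a where a: "G p = ereal a"
    using pd assms(1) by (cases "G p") (auto simp: edom_def proper_fun_def)
  obtain b where b: "G z = ereal b"
    using zd assms(1) by (cases "G z") (auto simp: edom_def proper_fun_def)
  have "0 \<le> ((p - u) \<bullet> (z - p) - (a - b)) + t * (1 / 2 * (norm (z - p))\<^sup>2)" if t: "0 < t" "t < 1" for t
  proof -
    let ?q = "(1 - t) *\<^sub>R p + t *\<^sub>R z"
    have "G ?q \<le> ereal ((1 - t) * a + t * b)"
      using assms(2)[unfolded convex_fun_def, rule_format, of t p z] t by (simp add: a b)
    then have "G ?q + ereal (1 / 2 * (norm (?q - u))\<^sup>2)
               \<le> ereal ((1 - t) * a + t * b) + ereal (1 / 2 * (norm (?q - u))\<^sup>2)"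
      by (rule add_right_mono)
    from order_trans[OF min this]
    have "a + 1 / 2 * (norm (p - u))\<^sup>2 \<le> (1 - t) * a + t * b + 1 / 2 * (norm (?q - u))\<^sup>2"
      by (simp add: a)
    moreover have "?q - u = (p - u) + t *\<^sub>R (z - p)"
      by (simp add: algebra_simps)
    then have "(norm (?q - u))\<^sup>2 = (norm (p - u))\<^sup>2 + 2 * t * ((p - u) \<bullet> (z - p)) + t\<^sup>2 * (norm (z - p))\<^sup>2"
      unfolding power2_norm_eq_inner by (simp add: inner_add inner_commute power2_eq_square algebra_simps)
    ultimately have "0 \<le> t * (((p - u) \<bullet> (z - p) - (a - b)) + t * (1 / 2 * (norm (z - p))\<^sup>2))"
      by (simp add: algebra_simps power2_eq_square)
    then show ?thesis
      using t by (simp add: zero_le_mult_iff)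
  qed
  from nonneg_if_perturbation_nonneg[OF this]
  show "real_of_ereal (G p) - real_of_ereal (G z) \<le> (p - u) \<bullet> (z - p)"
    by (simp add: a b)
qed

text \<open>This moves all later arithmetic from \<open>ereal\<close> to the reals; outside the
  domain the inequality is trivial because \<open>g xs\<close> is finite.\<close>

lemma solutions_iff:
  assumes "proper_fun g"
  shows "xs \<in> solutions F g \<longleftrightarrow> xs \<in> edom g \<and>
    (\<forall>z\<in>edom g. 0 \<le> F xs \<bullet> (z - xs) + real_of_ereal (g z) - real_of_ereal (g xs))"
    (is "_ \<longleftrightarrow> ?R")
proof
  have fin: "\<exists>r. g z = ereal r" if "z \<in> edom g" for z
    using that assms by (cases "g z") (auto simp: edom_def proper_fun_def)
  {
    assume s: "xs \<in> solutions F g"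
    obtain w where w: "w \<in> edom g"
      using assms by (auto simp: proper_fun_def)
    have xd: "xs \<in> edom g"
      using s fin[OF w] unfolding solutions_def edom_def 
      by (cases "g xs") (auto dest!: spec[of _ w])
    moreover have "0 \<le> F xs \<bullet> (z - xs) + real_of_ereal (g z) - real_of_ereal (g xs)" if "z \<in> edom g" for z
    proof -
      have "0 \<le> ereal (F xs \<bullet> (z - xs)) + g z - g xs"
        using s by (simp add: solutions_def)
      with fin[OF that] fin[OF xd] show ?thesis
        by (auto simp: zero_ereal_def)
    qed
    ultimately show ?R by blast
  }
  {
    assume R: ?R
    then obtain a where a: "g xs = ereal a" using fin by blast
    have "0 \<le> ereal (F xs \<bullet> (z - xs)) + g z - g xs" for z
    proof (cases "z \<in> edom g")
      case True
      then have "0 \<le> F xs \<bullet> (z - xs) + real_of_ereal (g z) - a"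
        using R a by force
      with fin[OF True] a show ?thesis by (auto simp: zero_ereal_def)
    next
      case False
      then have "g z = \<infinity>" by (simp add: edom_def)
      then show ?thesis by (simp add: a)
    qed
    then show "xs \<in> solutions F g" by (simp add: solutions_def)
  }
qed

section \<open>Positive multiples of a convex function\<close>

lemma edom_scaled: "0 < l \<Longrightarrow> edom (\<lambda>u. ereal l * g u) = edom g"
  unfolding edom_def by (rule Collect_cong) (simp add: less_top[symmetric])

lemma proper_fun_scaled:
  assumes "0 < l" "proper_fun g"
  shows "proper_fun (\<lambda>u. ereal l * g u)"
proof -
  have "ereal l * g z \<noteq> -\<infinity>" for z
    using assms by (cases "g z") (auto simp: proper_fun_def)
  then show ?thesis
    using assms(2) unfolding proper_fun_def edom_scaled[OF assms(1)] by blast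
qed

lemma lsc_fun_scaled:
  fixes g :: "'a::euclidean_space \<Rightarrow> ereal"
  assumes "0 < l" "lsc_fun g"
  shows "lsc_fun (\<lambda>u. ereal l * g u)"
  using assms by (auto simp: lsc_fun_def Liminf_ereal_mult_left intro!: ereal_mult_left_mono)

lemma convex_fun_scaled:
  assumes "0 < l" "proper_fun g" "convex_fun g"
  shows "convex_fun (\<lambda>u. ereal l * g u)"
  unfolding convex_fun_def
proof (intro allI ballI)
  fix x y and t :: real
  assume t: "t \<in> {0<..<1}"
  have ninf: "g x \<noteq> -\<infinity>" "g y \<noteq> -\<infinity>"
    using assms(2) by (auto simp: proper_fun_def)
  have "ereal l * g ((1 - t) *\<^sub>R x + t *\<^sub>R y) \<le> ereal l * (ereal (1 - t) * g x + ereal t * g y)"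
    using assms t by (intro ereal_mult_left_mono) (auto simp: convex_fun_def)
  also have "\<dots> = ereal (1 - t) * (ereal l * g x) + ereal t * (ereal l * g y)"
    using ninf t assms(1) by (cases "g x"; cases "g y") (auto simp: algebra_simps)
  finally show "ereal l * g ((1 - t) *\<^sub>R x + t *\<^sub>R y)
      \<le> ereal (1 - t) * (ereal l * g x) + ereal t * (ereal l * g y)" .
qed

text \<open>A solution \<open>s\<close> itself provides the affine minorant
  \<open>g s - F s \<bullet> (z - s)\<close> from which the proximal point is known to
  exist.\<close>

lemma prox_step_variational:
  fixes g :: "'a::euclidean_space \<Rightarrow> ereal"
  assumes g: "proper_fun g" "lsc_fun g" "convex_fun g"
    and s: "s \<in> solutions F g" and l: "0 < l"
    and p: "p = prox (\<lambda>u. ereal l * g u) (w - l *\<^sub>R v)"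
  shows "p \<in> edom g"
    and "z \<in> edom g \<Longrightarrow> l * (real_of_ereal (g p) - real_of_ereal (g z)) \<le> (p - w + l *\<^sub>R v) \<bullet> (z - p)"
proof -
  let ?G = "\<lambda>u. ereal l * g u"
  have minorant: "ereal (l * (real_of_ereal (g s) + F s \<bullet> s) + (- l *\<^sub>R F s) \<bullet> z) \<le> ?G z" for z
  proof (cases "z \<in> edom g")
    case True
    then obtain b where b: "g z = ereal b"
      using g(1) by (cases "g z") (auto simp: edom_def proper_fun_def)
    have "0 \<le> F s \<bullet> (z - s) + b - real_of_ereal (g s)"
      using s True b by (force simp: solutions_iff[OF g(1)])
    then have "0 \<le> l * (F s \<bullet> (z - s) + b - real_of_ereal (g s))"
      using l by simp
    then show ?thesis by (simp add: b algebra_simps)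
  next
    case False
    then show ?thesis using l by (simp add: edom_def)
  qed
  have "?G p + ereal (1 / 2 * (norm (p - (w - l *\<^sub>R v)))\<^sup>2)
      \<le> ?G z + ereal (1 / 2 * (norm (z - (w - l *\<^sub>R v)))\<^sup>2)" for z
    unfolding p by (rule prox_minimizes[OF proper_fun_scaled[OF l g(1)] lsc_fun_scaled[OF l g(2)] minorant])
  note min = minimizer_variational[OF proper_fun_scaled[OF l g(1)] convex_fun_scaled[OF l g(1,3)] this,
      unfolded edom_scaled[OF l]]
  show "p \<in> edom g"
    by (rule min(1))
  show "z \<in> edom g \<Longrightarrow> l * (real_of_ereal (g p) - real_of_ereal (g z)) \<le> (p - w + l *\<^sub>R v) \<bullet> (z - p)"
    using min(2)[of z] by (simp add: real_of_ereal_mult right_diff_distrib algebra_simps)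
qed

subsection \<open>The energy argument\<close>

text \<open>Here \<open>a\<close>, \<open>b\<close>, \<open>c\<close> are three successive iterates.
  The current proximal inequality is tested at \<open>xs\<close>, the previous one at
  \<open>c\<close> and \<open>a\<close>; monotonicity then replaces \<open>A\<close> by
  \<open>Fs\<close>.\<close>

lemma extrapolated_step_inequality:
  fixes a b c xs A B Fs :: "'a::real_inner"
  assumes t: "0 < t" and lam: "0 < lam"
    and y: "y = extrapolate b a t"
    and curr: "lam * (gc - gs) \<le> (c - b + lam *\<^sub>R A) \<bullet> (xs - c)"
    and prev_c: "lp * (gb - gc) \<le> (b - a + lp *\<^sub>R B) \<bullet> (c - b)"
    and prev_a: "lp * (gb - ga) \<le> (b - a + lp *\<^sub>R B) \<bullet> (a - b)"
    and step: "lam * ga = lp * t * ga" "lam * gb = lp * t * gb" "lam * gc = lp * t * gc"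
    and mono: "0 \<le> (A - Fs) \<bullet> (y - xs)"
  shows "(norm (c - xs))\<^sup>2 + 2 * (lam * (1 + t) * (Fs \<bullet> (b - xs) + gb - gs))
    \<le> (norm (b - xs))\<^sup>2 + 2 * (lam * t * (Fs \<bullet> (a - xs) + ga - gs))
       - (norm (y - b))\<^sup>2 - (norm (c - y))\<^sup>2 + 2 * ((lam *\<^sub>R A - (lp * t) *\<^sub>R B) \<bullet> (y - c))"
proof -
  \<comment> \<open>The weights \<open>t\<close> and \<open>t * t\<close> merge the displacements
    \<open>c - b\<close> and \<open>a - b\<close> into \<open>t *\<^sub>R (c - y)\<close>, and
    \<open>t *\<^sub>R (b - a)\<close> is \<open>y - b\<close>.\<close>
  have "t * (lp * (gb - gc)) + t * t * (lp * (gb - ga))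
        \<le> t * ((b - a + lp *\<^sub>R B) \<bullet> (c - b)) + t * t * ((b - a + lp *\<^sub>R B) \<bullet> (a - b))"
    using t by (intro add_mono mult_left_mono prev_c prev_a) auto
  also have "\<dots> = (y - b + (lp * t) *\<^sub>R B) \<bullet> (c - y)"
    by (simp add: y extrapolate_def algebra_simps inner_add inner_diff)
  also have "t * (lp * (gb - gc)) + t * t * (lp * (gb - ga))
      = lp * t * gb - lp * t * gc + t * (lp * t * gb) - t * (lp * t * ga)"
    by (simp add: algebra_simps)
  also have "\<dots> = lam * gb - lam * gc + t * (lam * gb) - t * (lam * ga)"
    by (simp add: step)
  finally have prev: "lam * gb - lam * gc + t * (lam * gb) - t * (lam * ga)
                      \<le> (y - b + (lp * t) *\<^sub>R B) \<bullet> (c - y)" .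
  have mono': "lam * (A \<bullet> (xs - y)) \<le> lam * (Fs \<bullet> (xs - y))"
    using lam mono by (intro mult_left_mono) (auto simp: inner_diff)
  \<comment> \<open>Since \<open>y\<close> is the affine combination of \<open>b\<close> and
    \<open>a\<close> with weights \<open>1 + t\<close> and \<open>- t\<close>, this term splits
    between the two gaps.\<close>
  have y': "Fs \<bullet> (xs - y) = t * (Fs \<bullet> (a - xs)) - (1 + t) * (Fs \<bullet> (b - xs))"
    by (simp add: y extrapolate_def algebra_simps inner_add inner_diff)
  \<comment> \<open>Polarization; \<open>(norm (c - b))\<^sup>2\<close> cancels when the two
    identities are added.\<close>
  have sq: "2 * ((c - b) \<bullet> (xs - c)) = (norm (b - xs))\<^sup>2 - (norm (c - b))\<^sup>2 - (norm (c - xs))\<^sup>2"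
    "2 * ((y - b) \<bullet> (c - y)) = (norm (c - b))\<^sup>2 - (norm (y - b))\<^sup>2 - (norm (c - y))\<^sup>2"
    unfolding power2_norm_eq_inner by (simp_all add: inner_diff inner_commute)
  have split: "(c - b + lam *\<^sub>R A) \<bullet> (xs - c) + (y - b + (lp * t) *\<^sub>R B) \<bullet> (c - y)
    = (c - b) \<bullet> (xs - c) + (y - b) \<bullet> (c - y) + lam * (A \<bullet> (xs - y))
      + (lam *\<^sub>R A - (lp * t) *\<^sub>R B) \<bullet> (y - c)"
    by (simp add: algebra_simps inner_add inner_diff)
  have "lam * (Fs \<bullet> (xs - y)) = lam * t * (Fs \<bullet> (a - xs)) - lam * (1 + t) * (Fs \<bullet> (b - xs))"
    unfolding y' by (simp add: algebra_simps)
  moreover have "lam * (1 + t) * (Fs \<bullet> (b - xs) + gb - gs)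
      = lam * (1 + t) * (Fs \<bullet> (b - xs)) + lam * gb + t * (lam * gb) - lam * gs - t * (lam * gs)"
    by (simp add: algebra_simps)
  moreover have "lam * t * (Fs \<bullet> (a - xs) + ga - gs)
      = lam * t * (Fs \<bullet> (a - xs)) + t * (lam * ga) - t * (lam * gs)"
    by (simp add: algebra_simps)
  moreover have "lam * gc - lam * gs \<le> (c - b + lam *\<^sub>R A) \<bullet> (xs - c)"
    using curr by (simp add: algebra_simps)
  ultimately show ?thesis
    using prev mono' sq split by linarith
qed

text \<open>The weights come from two nonnegative squares and
  \<open>(sqrt 2 - 1) * (1 + sqrt 2) = 1\<close>. They are chosen so that in the energy estimate the
  \<open>w\<close> term cancels against the previous energy and both remaining residuals get the
  same factor \<open>1 - \<alpha> * (1 + sqrt 2)\<close>.\<close>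

lemma norm_product_absorption:
  fixes u w q :: "'a::real_normed_vector"
  shows "2 * norm (u + w) * norm q
    \<le> (1 + sqrt 2) * (norm u)\<^sup>2 + (norm w)\<^sup>2 + sqrt 2 * (norm q)\<^sup>2"
proof -
  let ?U = "norm u" and ?W = "norm w" and ?Q = "norm q" and ?s = "sqrt 2"
  have "2 * norm (u + w) * ?Q \<le> 2 * (?U + ?W) * ?Q"
    by (intro mult_right_mono mult_left_mono norm_triangle_ineq) auto
  moreover have "0 \<le> (?W - ?Q)\<^sup>2 + (?s - 1) * (?Q - (1 + ?s) * ?U)\<^sup>2"
    by (intro add_nonneg_nonneg mult_nonneg_nonneg) auto
  moreover have "(?s - 1) * (?Q - (1 + ?s) * ?U)\<^sup>2 = (?s - 1) * ?Q\<^sup>2 - 2 * ?Q * ?U + (1 + ?s) * ?U\<^sup>2"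
  proof -
    have k: "(?s - 1) * (1 + ?s) = 1"
      by (simp add: algebra_simps)
    have "(?s - 1) * (?Q - (1 + ?s) * ?U)\<^sup>2
      = (?s - 1) * ?Q\<^sup>2 - 2 * ((?s - 1) * (1 + ?s)) * ?Q * ?U + ((?s - 1) * (1 + ?s)) * ((1 + ?s) * ?U\<^sup>2)"
      by algebra
    then show ?thesis
      by (simp only: k)
  qed
  ultimately show ?thesis
    by (simp add: power2_eq_square algebra_simps)
qed

text \<open>The assumption \<open>scale\<close> covers both algorithms: in Algorithm 2 the two step sizes
  \<open>\<lambda>\<^sub>n\<^sub>+\<^sub>1\<close> and \<open>\<tau>\<^sub>n\<^sub>+\<^sub>1 \<lambda>\<^sub>n\<close> agree, and in Algorithm 1 the function \<open>g\<close> vanishes on its domain.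
  No lower bound on the step sizes is assumed, since in Algorithm 1 the largest admissible step can
  be arbitrarily small after a step above the threshold in \<open>no_decay\<close>. Membership of
  \<open>x n\<close> in the domain starts at \<open>n = 2\<close>, as \<open>x 0\<close> and \<open>x 1\<close> are arbitrary.\<close>

locale extrapolated_iteration =
  fixes F :: "'a::euclidean_space \<Rightarrow> 'a" and g :: "'a \<Rightarrow> ereal" and \<alpha> M :: real
    and x y :: "nat \<Rightarrow> 'a" and lam \<tau> :: "nat \<Rightarrow> real"
  assumes lipschitz: "locally_lipschitz F"
    and monotone: "monotone_operator F"
    and proper: "proper_fun g"
    and lsc: "lsc_fun g"
    and cont: "continuous_on (edom g) g"
    and \<alpha>: "0 < \<alpha>" "\<alpha> < sqrt 2 - 1"
    and lam_pos: "0 < lam n"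
    and lam_le: "lam n \<le> M"
    and \<tau>_pos: "0 < \<tau> n"
    and \<tau>_le: "\<tau> n \<le> 2"
    and y_eq: "y (Suc n) = extrapolate (x (Suc n)) (x n) (\<tau> (Suc n))"
    and step: "norm (lam (Suc n) *\<^sub>R F (y (Suc n)) - (lam n * \<tau> (Suc n)) *\<^sub>R F (y n))
                 \<le> \<alpha> * norm (y (Suc n) - y n)"
    and coupling: "lam (Suc n) * \<tau> (Suc n) \<le> (1 + \<tau> n) * lam n"
    and scale: "z \<in> edom g \<Longrightarrow>
          lam (Suc n) * real_of_ereal (g z) = lam n * \<tau> (Suc n) * real_of_ereal (g z)"
    and iterate_mem: "0 < n \<Longrightarrow> x (Suc n) \<in> edom g"
    and iterate: "0 < n \<Longrightarrow> z \<in> edom g \<Longrightarrow>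
          lam n * (real_of_ereal (g (x (Suc n))) - real_of_ereal (g z))
            \<le> (x (Suc n) - x n + lam n *\<^sub>R F (y n)) \<bullet> (z - x (Suc n))"
    and no_decay: "L-lipschitz_on S F \<Longrightarrow> 0 < L \<Longrightarrow>
          \<exists>c>0. \<forall>n>0. y n \<in> S \<longrightarrow> (\<forall>t\<in>{0..2}. extrapolate (x (Suc n)) (x n) t \<in> S) \<longrightarrow>
            lam n \<le> c \<longrightarrow> lam n \<le> lam (Suc n)"
begin

section \<open>Energy descent, cluster points and convergence\<close>

abbreviation gr :: "'a \<Rightarrow> real" where
  "gr z \<equiv> real_of_ereal (g z)"

definition gap :: "'a \<Rightarrow> 'a \<Rightarrow> real" where
  "gap s z = F s \<bullet> (z - s) + gr z - gr s"

definition energy :: "'a \<Rightarrow> nat \<Rightarrow> real" where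
  "energy s n = (norm (x (Suc n) - s))\<^sup>2 + 2 * (lam n * (1 + \<tau> n) * gap s (x n))
     + \<alpha> * (norm (x (Suc n) - y n))\<^sup>2"

lemma g_real: "z \<in> edom g \<Longrightarrow> g z = ereal (gr z)"
  using proper by (cases "g z") (auto simp: edom_def proper_fun_def)

lemma continuous_on_gr: "continuous_on (edom g) gr"
proof -
  have "\<bar>g z\<bar> \<noteq> \<infinity>" if "z \<in> edom g" for z
    using that proper by (cases "g z") (auto simp: edom_def proper_fun_def)
  then have "continuous_on (edom g) g \<longleftrightarrow> continuous_on (edom g) (real_of_ereal \<circ> g)"
    by (rule continuous_on_iff_real)
  with cont show ?thesis
    by (simp add: o_def)
qed

lemma continuous_F: "continuous_on UNIV F"
  using local_lipschitz_continuous_on[OF lipschitz[unfolded locally_lipschitz_def] UNIV_I] .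

lemma iterate_mem': "2 \<le> n \<Longrightarrow> x n \<in> edom g"
  using iterate_mem[of "n - 1"] by auto

lemma gap_nonneg: "s \<in> solutions F g \<Longrightarrow> z \<in> edom g \<Longrightarrow> 0 \<le> gap s z"
  by (simp add: solutions_iff[OF proper] gap_def)

lemma energy_descent:
  assumes s: "s \<in> solutions F g" and n: "2 \<le> n"
  shows "energy s (Suc n)
      + (1 - \<alpha> * (1 + sqrt 2)) * ((norm (y (Suc n) - x (Suc n)))\<^sup>2 + (norm (x (Suc (Suc n)) - y (Suc n)))\<^sup>2)
    \<le> energy s n"
proof -
  let ?a = "x n" and ?b = "x (Suc n)" and ?c = "x (Suc (Suc n))"
  let ?y = "y (Suc n)" and ?l = "lam (Suc n)" and ?t = "\<tau> (Suc n)"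
  let ?d = "?l *\<^sub>R F ?y - (lam n * ?t) *\<^sub>R F (y n)"
  have mem: "?a \<in> edom g" "?b \<in> edom g" "?c \<in> edom g" "s \<in> edom g"
    using n s by (auto intro: iterate_mem' simp: solutions_iff[OF proper])
  have "(norm (?c - s))\<^sup>2 + 2 * (?l * (1 + ?t) * gap s ?b)
    \<le> (norm (?b - s))\<^sup>2 + 2 * (?l * ?t * gap s ?a)
       - (norm (?y - ?b))\<^sup>2 - (norm (?c - ?y))\<^sup>2 + 2 * (?d \<bullet> (?y - ?c))"
    unfolding gap_def using n monotone
    by (intro extrapolated_step_inequality[where gc = "gr ?c" and lp = "lam n"] scale mem iterate y_eq \<tau>_pos lam_pos)
      (auto simp: monotone_operator_def)
  \<comment> \<open>\<open>coupling\<close> makes the gap term left by this step no larger than the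
    one stored in the previous energy.\<close>
  moreover have "?l * ?t * gap s ?a \<le> lam n * (1 + \<tau> n) * gap s ?a"
    using coupling[of n] gap_nonneg[OF s mem(1)] by (intro mult_right_mono) (auto simp: mult.commute)
  moreover have "2 * (?d \<bullet> (?y - ?c)) \<le> \<alpha> * (2 * norm (?y - y n) * norm (?c - ?y))"
  proof -
    have "?d \<bullet> (?y - ?c) \<le> norm ?d * norm (?c - ?y)"
      using norm_cauchy_schwarz[of ?d "?y - ?c"] by (simp add: norm_minus_commute)
    also have "\<dots> \<le> \<alpha> * norm (?y - y n) * norm (?c - ?y)"
      by (intro mult_right_mono step) auto
    finally show ?thesis by simp
  qed
  \<comment> \<open>The middle square, with weight \<open>\<alpha>\<close>, is exactly the last term
    of \<open>energy s n\<close>.\<close>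
  moreover have "\<alpha> * (2 * norm (?y - y n) * norm (?c - ?y))
      \<le> \<alpha> * ((1 + sqrt 2) * (norm (?y - ?b))\<^sup>2 + (norm (?b - y n))\<^sup>2 + sqrt 2 * (norm (?c - ?y))\<^sup>2)"
    using norm_product_absorption[of "?y - ?b" "?b - y n" "?c - ?y"] \<alpha>
    by (intro mult_left_mono) auto
  ultimately show ?thesis
    unfolding energy_def by (simp add: algebra_simps)
qed

lemma energy_ge:
  assumes "s \<in> solutions F g" "2 \<le> n"
  shows "(norm (x (Suc n) - s))\<^sup>2 \<le> energy s n"
  using gap_nonneg[OF assms(1) iterate_mem'[OF assms(2)]] \<alpha> lam_pos[of n] \<tau>_pos[of n]
  by (simp add: energy_def)

text \<open>The bound \<open>\<alpha> < sqrt 2 - 1\<close> is exactly what is needed, since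
  \<open>sqrt 2 - 1\<close> is the reciprocal of \<open>1 + sqrt 2\<close>.\<close>

lemma contraction_factor_pos: "0 < 1 - \<alpha> * (1 + sqrt 2)"
proof -
  have "\<alpha> * (1 + sqrt 2) < (sqrt 2 - 1) * (1 + sqrt 2)"
    using \<alpha> by (intro mult_strict_right_mono) (auto intro: add_pos_nonneg)
  also have "\<dots> = 1" by (simp add: algebra_simps)
  finally show ?thesis by simp
qed

lemma energy_decseq:
  assumes "s \<in> solutions F g"
  shows "decseq (\<lambda>n. energy s (n + 2))"
proof (rule decseq_SucI)
  fix n
  have "0 \<le> (1 - \<alpha> * (1 + sqrt 2)) * ((norm (y (Suc (n + 2)) - x (Suc (n + 2))))\<^sup>2
          + (norm (x (Suc (Suc (n + 2))) - y (Suc (n + 2))))\<^sup>2)"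
    using contraction_factor_pos by (intro mult_nonneg_nonneg) auto
  then show "energy s (Suc n + 2) \<le> energy s (n + 2)"
    using energy_descent[OF assms, of "n + 2"] by simp
qed

lemma energy_convergent:
  assumes "s \<in> solutions F g"
  obtains l where "energy s \<longlonglongrightarrow> l"
proof -
  have "\<forall>n. 0 \<le> energy s (n + 2)"
    using order_trans[OF zero_le_power2 energy_ge[OF assms]] by simp
  then obtain l where "(\<lambda>n. energy s (n + 2)) \<longlonglongrightarrow> l"
    using decseq_convergent[OF energy_decseq[OF assms]] by metis
  then show ?thesis
    by (intro that LIMSEQ_offset[of "energy s" 2])
qed

text \<open>A convergent energy has vanishing increments, and these dominate the squared residuals
  by the descent estimate.\<close>

lemma residuals_tendsto_0:
  assumes s: "s \<in> solutions F g"
  shows "(\<lambda>n. y n - x n) \<longlonglongrightarrow> 0" "(\<lambda>n. x (Suc n) - y n) \<longlonglongrightarrow> 0"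
proof -
  define k where "k = 1 - \<alpha> * (1 + sqrt 2)"
  define R where "R = (\<lambda>n. (norm (y (Suc n) - x (Suc n)))\<^sup>2 + (norm (x (Suc (Suc n)) - y (Suc n)))\<^sup>2)"
  obtain l where l: "energy s \<longlonglongrightarrow> l"
    using energy_convergent[OF s] .
  have lim: "(\<lambda>n. (energy s n - energy s (Suc n)) / k) \<longlonglongrightarrow> 0"
    using tendsto_divide[OF tendsto_diff[OF l LIMSEQ_Suc[OF l]] tendsto_const[of k]] contraction_factor_pos
    by (simp add: k_def)
  have "R n \<le> (energy s n - energy s (Suc n)) / k" if "2 \<le> n" for n
    using energy_descent[OF s that] contraction_factor_pos
    by (simp add: R_def k_def pos_le_divide_eq mult.commute)
  then have ev: "\<forall>\<^sub>F n in sequentially. R n \<le> (energy s n - energy s (Suc n)) / k"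
    using eventually_sequentially by blast
  have "R \<longlonglongrightarrow> 0"
    by (rule tendsto_sandwich[OF _ ev tendsto_const lim]) (auto simp: R_def)
  then have "(\<lambda>n. sqrt (R n)) \<longlonglongrightarrow> 0"
    using tendsto_real_sqrt by fastforce
  then have "(\<lambda>n. y (Suc n) - x (Suc n)) \<longlonglongrightarrow> 0" "(\<lambda>n. x (Suc (Suc n)) - y (Suc n)) \<longlonglongrightarrow> 0"
    by (rule Lim_null_comparison[rotated]; auto simp: R_def intro!: always_eventually real_le_rsqrt)+
  then show "(\<lambda>n. y n - x n) \<longlonglongrightarrow> 0" "(\<lambda>n. x (Suc n) - y n) \<longlonglongrightarrow> 0"
    using LIMSEQ_imp_Suc[of "\<lambda>n. y n - x n"] LIMSEQ_imp_Suc[of "\<lambda>n. x (Suc n) - y n"] by simp_all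
qed

lemma iterates_bounded:
  assumes s: "s \<in> solutions F g"
  shows "Bseq x"
proof -
  \<comment> \<open>The energy is monotone from index 2 on, and \<open>energy s (n + 2)\<close>
    controls \<open>x (n + 3)\<close>.\<close>
  have "norm (x (n + 3) - s) \<le> sqrt (energy s 2)" for n
  proof (rule real_le_rsqrt)
    have "(norm (x (n + 3) - s))\<^sup>2 \<le> energy s (n + 2)"
      using energy_ge[OF s, of "n + 2"] by (simp add: numeral_3_eq_3)
    also have "\<dots> \<le> energy s 2"
      using decseqD[OF energy_decseq[OF s], of 0 n] by (simp add: numeral_2_eq_2)
    finally show "(norm (x (n + 3) - s))\<^sup>2 \<le> energy s 2" .
  qed
  then have "norm (x (n + 3)) \<le> sqrt (energy s 2) + norm s" for n
    using norm_triangle_sub[of "x (n + 3)" s] by (smt (verit))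
  then have "Bseq (\<lambda>n. x (n + 3))"
    by (rule BseqI')
  then show ?thesis
    by (rule Bseq_offset)
qed

text \<open>If the steps are not frequently above the threshold of \<open>no_decay\<close>, they are
  eventually below it and therefore nondecreasing, so one of them is a lower bound for the
  rest.\<close>

lemma frequently_steps_bounded_below:
  assumes s: "s \<in> solutions F g"
  obtains c where "0 < c" "\<exists>\<^sub>F n in sequentially. c \<le> lam n"
proof -
  obtain R where R: "\<And>n. norm (x n) \<le> R"
    using iterates_bounded[OF s] by (auto simp: Bseq_def)
  \<comment> \<open>The radius is \<open>R + 2 * (R + R)\<close>, for extrapolation factors up to
    2.\<close>
  define S where "S = cball (0::'a) (5 * R)"
  have inS: "extrapolate (x (Suc n)) (x n) t \<in> S" if "t \<in> {0..2}" for n t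
  proof -
    have "norm (x (Suc n) + t *\<^sub>R (x (Suc n) - x n)) \<le> norm (x (Suc n)) + t * norm (x (Suc n) - x n)"
      using that norm_triangle_ineq[of "x (Suc n)" "t *\<^sub>R (x (Suc n) - x n)"] by simp
    also have "\<dots> \<le> R + 2 * (R + R)"
      using that R[of n] R[of "Suc n"] norm_triangle_ineq4[of "x (Suc n)" "x n"]
      by (intro add_mono mult_mono) auto
    finally show ?thesis by (simp add: S_def extrapolate_def)
  qed
  have yS: "y n \<in> S" if "0 < n" for n
    using that inS[of "\<tau> n" "n - 1"] y_eq[of "n - 1"] \<tau>_pos[of n] \<tau>_le[of n] by simp
  \<comment> \<open>On the compact set of times \<open>{0}\<close> and the compact \<open>S\<close>,
    the local Lipschitz condition becomes uniform.\<close>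
  have "local_lipschitz {0} S (\<lambda>_::real. F)"
    using lipschitz unfolding locally_lipschitz_def by (rule local_lipschitz_subset) auto
  then obtain L where "L-lipschitz_on S F"
    by (rule local_lipschitz_compact_implies_lipschitz[of "{0}" S]) (auto simp: S_def)
  \<comment> \<open>\<open>no_decay\<close> asks for a positive constant.\<close>
  then have "(max L 1)-lipschitz_on S F"
    by (rule lipschitz_on_mono) auto
  then obtain c where c: "0 < c" and mono: "\<forall>n>0. lam n \<le> c \<longrightarrow> lam n \<le> lam (Suc n)"
    using no_decay[of "max L 1" S] inS yS by (auto simp: less_max_iff_disj)
  show ?thesis
  proof (cases "\<exists>\<^sub>F n in sequentially. c \<le> lam n")
    case True
    with c that show ?thesis by blast
  next
    case False
    then obtain N where N: "\<And>n. N \<le> n \<Longrightarrow> lam n < c"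
      by (auto simp: not_frequently eventually_sequentially not_le)
    \<comment> \<open>Starting at \<open>Suc N\<close> keeps the index positive, as
      \<open>mono\<close> requires.\<close>
    have "lam (Suc N) \<le> lam n" if "Suc N \<le> n" for n
      using that
    proof (induction rule: dec_induct)
      case (step n)
      then have "lam n \<le> lam (Suc n)"
        using N[of n] mono by auto
      with step show ?case by linarith
    qed simp
    then have "\<exists>\<^sub>F n in sequentially. lam (Suc N) \<le> lam n"
      by (auto simp: frequently_sequentially) (meson nat_le_linear order_refl)
    with lam_pos that show ?thesis by blast
  qed
qed

text \<open>Divided by the step size, the proximal inequality passes to the limit: the lower bound
  \<open>c\<close> makes the scaled displacement vanish, and lower semicontinuity handles
  \<open>g\<close> at the iterates.\<close>

lemma cluster_point_solution:
  assumes s: "s \<in> solutions F g" and r: "strict_mono r" and c: "0 < c" "\<And>k. c \<le> lam (r k)"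
    and lim: "(x \<circ> r) \<longlonglongrightarrow> p"
  shows "p \<in> solutions F g"
proof -
  note sub = LIMSEQ_subseq_LIMSEQ[OF _ r, unfolded o_def]
  have xr: "(\<lambda>k. x (r k)) \<longlonglongrightarrow> p"
    using lim by (simp add: o_def)
  have yr: "(\<lambda>k. y (r k)) \<longlonglongrightarrow> p"
    using tendsto_add[OF sub[OF residuals_tendsto_0(1)[OF s]] xr] by simp
  have xr': "(\<lambda>k. x (Suc (r k))) \<longlonglongrightarrow> p"
    using tendsto_add[OF sub[OF residuals_tendsto_0(2)[OF s]] yr] by simp
  have Fr: "(\<lambda>k. F (y (r k))) \<longlonglongrightarrow> F p"
    using continuous_on_tendsto_compose[OF continuous_F yr] by simp
  have q: "(\<lambda>k. (1 / lam (r k)) *\<^sub>R (x (Suc (r k)) - x (r k))) \<longlonglongrightarrow> 0"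
  proof (rule Lim_null_comparison)
    show "(\<lambda>k. (1 / c) * norm (x (Suc (r k)) - x (r k))) \<longlonglongrightarrow> 0"
      using tendsto_mult_left[OF tendsto_norm[OF tendsto_diff[OF xr' xr]], of "1 / c"] by simp
    show "\<forall>\<^sub>F k in sequentially. norm ((1 / lam (r k)) *\<^sub>R (x (Suc (r k)) - x (r k)))
            \<le> (1 / c) * norm (x (Suc (r k)) - x (r k))"
    proof (intro always_eventually allI)
      fix k
      have "1 / lam (r k) \<le> 1 / c"
        using c by (intro frac_le) auto
      then show "norm ((1 / lam (r k)) *\<^sub>R (x (Suc (r k)) - x (r k)))
            \<le> (1 / c) * norm (x (Suc (r k)) - x (r k))"
        using lam_pos[of "r k"] mult_right_mono[of "1 / lam (r k)" "1 / c" "norm (x (Suc (r k)) - x (r k))"]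
        by simp
    qed
  qed
  have key: "g p \<le> ereal (F p \<bullet> (z - p) + gr z)" if z: "z \<in> edom g" for z
  proof (rule ccontr)
    assume "\<not> ?thesis"
    \<comment> \<open>A real separator also covers \<open>g p = \<infinity>\<close>, which is not
      yet excluded.\<close>
    then obtain m where m: "F p \<bullet> (z - p) + gr z < m" "ereal m < g p"
      using ereal_dense2[of "ereal (F p \<bullet> (z - p) + gr z)" "g p"] by (auto simp: not_le)
    have "\<forall>\<^sub>F k in sequentially. ereal m < g (x (Suc (r k)))"
      using lsc_fun_eventually[OF lsc m(2)] xr' by (auto simp: filterlim_iff)
    moreover have "\<forall>\<^sub>F k in sequentially. 0 < r k"
      using r by (metis eventually_gt_at_top filterlim_iff filterlim_subseq)
    ultimately have "\<forall>\<^sub>F k in sequentially.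
        m \<le> ((1 / lam (r k)) *\<^sub>R (x (Suc (r k)) - x (r k)) + F (y (r k))) \<bullet> (z - x (Suc (r k))) + gr z"
    proof eventually_elim
      case (elim k)
      let ?l = "lam (r k)" and ?u = "x (Suc (r k))"
      have "?l * (gr ?u - gr z) \<le> (?u - x (r k) + ?l *\<^sub>R F (y (r k))) \<bullet> (z - ?u)"
        using iterate[OF elim(2) z] .
      also have "\<dots> = ?l * (((1 / ?l) *\<^sub>R (?u - x (r k)) + F (y (r k))) \<bullet> (z - ?u))"
        using lam_pos[of "r k"] by (simp add: inner_add_left distrib_left)
      finally have "gr ?u - gr z \<le> ((1 / ?l) *\<^sub>R (?u - x (r k)) + F (y (r k))) \<bullet> (z - ?u)"
        using lam_pos[of "r k"] by simp
      moreover have "m < gr ?u"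
        using less_ereal.simps(1)[THEN iffD1] elim(1) g_real[OF iterate_mem[OF elim(2)]] by metis
      ultimately show ?case by linarith
    qed
    moreover have "(\<lambda>k. ((1 / lam (r k)) *\<^sub>R (x (Suc (r k)) - x (r k)) + F (y (r k))) \<bullet> (z - x (Suc (r k))) + gr z)
        \<longlonglongrightarrow> (0 + F p) \<bullet> (z - p) + gr z"
      by (intro tendsto_intros q Fr xr')
    ultimately have "m \<le> (0 + F p) \<bullet> (z - p) + gr z"
      by (intro tendsto_lowerbound) auto
    with m(1) show False by simp
  qed
  \<comment> \<open>Testing \<open>key\<close> at a point of the domain shows that
    \<open>g p\<close> is finite.\<close>
  have "s \<in> edom g"
    using s by (simp add: solutions_iff[OF proper])
  from key[OF this] have p: "p \<in> edom g"
    by (auto simp: edom_def)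
  have "gr p \<le> F p \<bullet> (z - p) + gr z" if "z \<in> edom g" for z
    using key[OF that] g_real[OF p] ereal_less_eq(3) by metis
  with p show ?thesis
    by (simp add: solutions_iff[OF proper])
qed

lemma converges:
  assumes "solutions F g \<noteq> {}"
  shows "\<exists>p\<in>solutions F g. x \<longlonglongrightarrow> p \<and> y \<longlonglongrightarrow> p"
proof -
  obtain s where s: "s \<in> solutions F g"
    using assms by blast
  obtain c where c: "0 < c" "\<exists>\<^sub>F n in sequentially. c \<le> lam n"
    using frequently_steps_bounded_below[OF s] .
  have "infinite {n. c \<le> lam n}"
    using c(2) unfolding cofinite_eq_sequentially[symmetric] frequently_cofinite .
  then obtain r0 :: "nat \<Rightarrow> nat" where r0: "strict_mono r0" "\<And>k. c \<le> lam (r0 k)"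
    using infinite_enumerate by blast
  have "bounded (range (x \<circ> r0))"
    using iterates_bounded[OF s] by (auto simp: Bseq_eq_bounded elim!: bounded_subset)
  then obtain p r1 where r1: "strict_mono (r1 :: nat \<Rightarrow> nat)" "((x \<circ> r0) \<circ> r1) \<longlonglongrightarrow> p"
    using bounded_imp_convergent_subsequence by blast
  define r where "r = r0 \<circ> r1"
  have r: "strict_mono r" "\<And>k. c \<le> lam (r k)" "(x \<circ> r) \<longlonglongrightarrow> p"
    using r0 r1 by (auto simp: r_def strict_mono_o o_assoc)
  have p: "p \<in> solutions F g"
    using cluster_point_solution[OF s r(1) c(1) r(2,3)] .
  note sub = LIMSEQ_subseq_LIMSEQ[OF _ r(1), unfolded o_def]
  note res = residuals_tendsto_0[OF s]
  have xr: "(\<lambda>k. x (r k)) \<longlonglongrightarrow> p"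
    using r(3) by (simp add: o_def)
  have xr': "(\<lambda>k. x (Suc (r k))) \<longlonglongrightarrow> p"
    using tendsto_add[OF sub[OF tendsto_add[OF res]] xr] by simp
  have pd: "p \<in> edom g"
    using p by (simp add: solutions_iff[OF proper])
  have ev2: "\<forall>\<^sub>F k in sequentially. 2 \<le> r k"
    using r(1) by (metis eventually_ge_at_top filterlim_iff filterlim_subseq)
  then have "\<forall>\<^sub>F k in sequentially. x (r k) \<in> edom g"
    by eventually_elim (rule iterate_mem')
  \<comment> \<open>Continuity of \<open>g\<close> on its domain gives convergence of the values,
    and so the gap at \<open>p\<close> vanishes along the subsequence.\<close>
  then have "(\<lambda>k. gr (x (r k))) \<longlonglongrightarrow> gr p"
    by (rule continuous_on_tendsto_compose[OF continuous_on_gr xr pd])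
  then have "(\<lambda>k. gap p (x (r k))) \<longlonglongrightarrow> F p \<bullet> (p - p) + gr p - gr p"
    unfolding gap_def by (intro tendsto_diff tendsto_add tendsto_inner tendsto_const xr)
  \<comment> \<open>\<open>M * 3\<close> bounds \<open>lam n * (1 + \<tau> n)\<close>, as
    \<open>\<tau> n \<le> 2\<close>.\<close>
  then have "(\<lambda>k. (M * 3) * gap p (x (r k))) \<longlonglongrightarrow> 0"
    using tendsto_mult_right_zero by fastforce
  moreover have "\<forall>\<^sub>F k in sequentially. norm (lam (r k) * (1 + \<tau> (r k)) * gap p (x (r k))) \<le> (M * 3) * gap p (x (r k))"
    using ev2
  proof eventually_elim
    case (elim k)
    have "lam (r k) * (1 + \<tau> (r k)) * gap p (x (r k)) \<le> (M * 3) * gap p (x (r k))"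
      using lam_le[of "r k"] \<tau>_le[of "r k"] lam_pos[of "r k"] \<tau>_pos[of "r k"] gap_nonneg[OF p iterate_mem'[OF elim]]
      by (intro mult_right_mono mult_mono) auto
    then show ?case
      using lam_pos[of "r k"] \<tau>_pos[of "r k"] gap_nonneg[OF p iterate_mem'[OF elim]] by simp
  qed
  ultimately have "(\<lambda>k. lam (r k) * (1 + \<tau> (r k)) * gap p (x (r k))) \<longlonglongrightarrow> 0"
    by (rule Lim_null_comparison[rotated])
  then have "(\<lambda>k. energy p (r k)) \<longlonglongrightarrow> (norm (p - p))\<^sup>2 + 2 * 0 + \<alpha> * (norm (0::'a))\<^sup>2"
    unfolding energy_def by (intro tendsto_intros xr' sub[OF res(2)])
  moreover obtain l where l: "energy p \<longlonglongrightarrow> l"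
    using energy_convergent[OF p] .
  \<comment> \<open>The whole energy sequence converges, so the subsequence determines its
    limit.\<close>
  ultimately have "energy p \<longlonglongrightarrow> 0"
    using LIMSEQ_unique[OF sub[OF l]] by auto
  then have "(\<lambda>n. sqrt (energy p n)) \<longlonglongrightarrow> 0"
    using tendsto_real_sqrt by fastforce
  moreover have "\<forall>\<^sub>F n in sequentially. norm (x (Suc n) - p) \<le> sqrt (energy p n)"
    using eventually_ge_at_top[of 2] by eventually_elim (auto intro: real_le_rsqrt energy_ge[OF p])
  ultimately have "(\<lambda>n. x (Suc n) - p) \<longlonglongrightarrow> 0"
    by (rule Lim_null_comparison[rotated])
  then have x: "x \<longlonglongrightarrow> p"
    by (rule LIMSEQ_imp_Suc[OF LIM_zero_cancel])
  from tendsto_add[OF res(1) this] have "y \<longlonglongrightarrow> p"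
    by simp
  with x p show ?thesis by blast
qed

end

subsection \<open>The two linesearches\<close>

text \<open>Shows that the search stops at the first \<open>t\<close> with any admissible step. The
  half-open range is cut off below at \<open>l0\<close>, which makes the remaining closed conditions
  compact.\<close>

lemma steps1_has_largest:
  assumes "l0 \<in> steps1 F \<alpha> lmax x xp yp lp tp t"
  shows "\<exists>m. is_largest (steps1 F \<alpha> lmax x xp yp lp tp t) m"
proof -
  let ?S = "steps1 F \<alpha> lmax x xp yp lp tp t" and ?cap = "min ((1 + tp) / t * lp) lmax"
  let ?T = "{l0..?cap} \<inter> {l. norm (l *\<^sub>R F (extrapolate x xp t) - (lp * t) *\<^sub>R F yp)
              \<le> \<alpha> * norm (extrapolate x xp t - yp)}"
  have "compact ?T"
    by (intro compact_Int_closed compact_Icc closed_Collect_le continuous_intros)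
  moreover have "l0 \<in> ?T"
    using assms by (auto simp: steps1_def)
  ultimately obtain m where m: "m \<in> ?T" "\<And>l. l \<in> ?T \<Longrightarrow> l \<le> m"
    using compact_attains_sup[of ?T] by (metis empty_iff)
  have "m \<in> ?S"
    using m(1) assms by (auto simp: steps1_def)
  moreover have "l \<le> m" if "l \<in> ?S" for l
  proof (cases "l0 \<le> l")
    case True
    then show ?thesis using that by (intro m(2)) (auto simp: steps1_def)
  next
    case False
    then show ?thesis using m(1) by simp
  qed
  ultimately show ?thesis
    by (auto simp: is_largest_def)
qed

text \<open>The bound 2 is self-reproducing. The squared bound yields \<open>coupling\<close>, the
  bound 1 caps the step size, and the first trial being at least 1 yields
  \<open>no_decay\<close>.\<close>

lemma trial2_bounds:
  assumes "0 < \<sigma>" "\<sigma> < 1" "0 < tp" "tp \<le> 2"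
  shows "0 < trial2 lmax \<sigma> lp tp i" "trial2 lmax \<sigma> lp tp i \<le> 2"
    "(trial2 lmax \<sigma> lp tp i)\<^sup>2 \<le> 1 + tp"
    "lmax / 2 < lp \<Longrightarrow> trial2 lmax \<sigma> lp tp i \<le> 1"
    "1 \<le> trial2 lmax \<sigma> lp tp 0"
proof -
  let ?t = "trial2 lmax \<sigma> lp tp i"
  have p: "0 < \<sigma> ^ i" "\<sigma> ^ i \<le> 1"
    using assms by (auto intro: power_le_one)
  show pos: "0 < ?t"
    using assms p by (auto simp: trial2_def)
  have "?t \<le> sqrt (1 + tp)"
    using assms p by (auto simp: trial2_def intro: mult_left_le order_trans[of _ 1])
  then have "?t\<^sup>2 \<le> (sqrt (1 + tp))\<^sup>2"
    using pos by (intro power_mono) auto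
  then show sq: "?t\<^sup>2 \<le> 1 + tp"
    using assms by simp
  show "?t \<le> 2"
    using sq assms by (intro power2_le_imp_le[of ?t 2]) auto
  show "lmax / 2 < lp \<Longrightarrow> ?t \<le> 1"
    using p by (simp add: trial2_def)
  show "1 \<le> trial2 lmax \<sigma> lp tp 0"
    using assms by (simp add: trial2_def)
qed

lemma algorithm1_extrapolated_iteration:
  fixes F :: "'a::euclidean_space \<Rightarrow> 'a"
  assumes F: "locally_lipschitz F" "monotone_operator F"
    and g: "proper_fun (delta C)" "lsc_fun (delta C)" "convex_fun (delta C)"
      "continuous_on (edom (delta C)) (delta C)"
    and s: "s \<in> solutions F (delta C)"
    and alg: "algorithm1 F C \<alpha> lmax \<sigma> x y lam \<tau>"
  shows "extrapolated_iteration F (delta C) \<alpha> (max (lam 0) lmax) x y lam \<tau>"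
proof -
  have init: "0 < \<alpha>" "\<alpha> < sqrt 2 - 1" "0 < lmax" "0 < \<sigma>" "\<sigma> < 1" "0 < lam 0" "\<tau> 0 = 1"
    using alg by (auto simp: algorithm1_def initialization_def)
  let ?steps = "\<lambda>n. steps1 F \<alpha> lmax (x (Suc n)) (x n) (y n) (lam n) (\<tau> n)"
  have ls: "\<exists>i. (\<forall>j<i. \<nexists>m. is_largest (?steps n (\<sigma> ^ j)) m) \<and> \<tau> (Suc n) = \<sigma> ^ i \<and>
      y (Suc n) = extrapolate (x (Suc n)) (x n) (\<tau> (Suc n)) \<and>
      is_largest (?steps n (\<tau> (Suc n))) (lam (Suc n))" for n
  proof -
    have "linesearch1 F \<alpha> lmax \<sigma> (x (Suc n)) (x n) (y n) (lam n) (\<tau> n) (\<tau> (Suc n)) (y (Suc n)) (lam (Suc n))"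
      using alg by (fastforce simp: algorithm1_def dest: spec[of _ "Suc n"])
    then show ?thesis
      by (simp only: linesearch1_def not_ex)
  qed
  have y: "y (Suc n) = extrapolate (x (Suc n)) (x n) (\<tau> (Suc n))" for n
    using ls[of n] by blast
  have largest: "is_largest (?steps n (\<tau> (Suc n))) (lam (Suc n))" for n
    using ls[of n] by blast
  then have mem: "lam (Suc n) \<in> ?steps n (\<tau> (Suc n))" for n
    by (simp add: is_largest_def)
  have lam_pos: "0 < lam n" for n
    using init(6) mem[of "n - 1"] by (cases n) (auto simp: steps1_def)
  have lam_lmax: "lam (Suc n) \<le> lmax" for n
    using mem[of n] by (auto simp: steps1_def)
  have tau: "0 < \<tau> n" "\<tau> n \<le> 1" for n
    using init ls[of "n - 1"] by (cases n; auto intro: power_le_one)+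
  have prox: "x (Suc n) = prox (\<lambda>u. ereal (lam n) * delta C u) (x n - lam n *\<^sub>R F (y n))" if "0 < n" for n
  proof -
    \<comment> \<open>An indicator function is unchanged by a positive factor, so the projection is
      a proximal step of any size.\<close>
    have "(\<lambda>u. ereal (lam n) * delta C u) = delta C"
      using lam_pos[of n] by (auto simp: delta_def)
    with alg that show ?thesis
      by (simp add: algorithm1_def proj_def)
  qed
  show ?thesis
  proof
    show "norm (lam (Suc n) *\<^sub>R F (y (Suc n)) - (lam n * \<tau> (Suc n)) *\<^sub>R F (y n))
            \<le> \<alpha> * norm (y (Suc n) - y n)" for n
      using mem[of n] unfolding y[of n] by (auto simp: steps1_def)
    show "lam (Suc n) * \<tau> (Suc n) \<le> (1 + \<tau> n) * lam n" for n
      using mem[of n] tau(1)[of "Suc n"] by (auto simp: steps1_def field_simps)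
    \<comment> \<open>Both sides vanish, since \<open>real_of_ereal \<infinity>\<close> is
      0.\<close>
    show "lam (Suc n) * real_of_ereal (delta C z) = lam n * \<tau> (Suc n) * real_of_ereal (delta C z)" for n z
      by (simp add: delta_def)
    show "lam n \<le> max (lam 0) lmax" for n
      using lam_lmax[of "n - 1"] by (cases n) auto
    show "\<tau> n \<le> 2" for n
      using tau(2)[of n] by simp
    fix L S
    assume L: "L-lipschitz_on S F" "0 < L"
    show "\<exists>c>0. \<forall>n>0. y n \<in> S \<longrightarrow> (\<forall>t\<in>{0..2}. extrapolate (x (Suc n)) (x n) t \<in> S) \<longrightarrow>
            lam n \<le> c \<longrightarrow> lam n \<le> lam (Suc n)"
    \<comment> \<open>Below \<open>\<alpha> / L\<close>, the unchanged step \<open>lam n\<close> is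
      admissible at the first trial \<open>\<tau> = 1\<close>.\<close>
    proof (intro exI[of _ "\<alpha> / L"] conjI allI impI)
      fix n :: nat
      assume n: "0 < n" "y n \<in> S" "\<forall>t\<in>{0..2}. extrapolate (x (Suc n)) (x n) t \<in> S" "lam n \<le> \<alpha> / L"
      let ?e = "extrapolate (x (Suc n)) (x n) 1"
      have "norm (lam n *\<^sub>R F ?e - lam n *\<^sub>R F (y n)) = lam n * norm (F ?e - F (y n))"
        using lam_pos[of n] by (simp flip: scaleR_diff_right)
      also have "\<dots> \<le> lam n * (L * norm (?e - y n))"
        using lipschitz_onD[OF L(1), of ?e "y n"] n lam_pos[of n]
        by (intro mult_left_mono) (auto simp: dist_norm)
      also have "\<dots> \<le> \<alpha> * norm (?e - y n)"
        using n(4) L(2) mult_right_mono[of "lam n * L" \<alpha> "norm (?e - y n)"] by (simp add: field_simps)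
      \<comment> \<open>\<open>n > 0\<close> matters: the initial \<open>lam 0\<close> may exceed
        \<open>lmax\<close>.\<close>
      finally have mem1: "lam n \<in> ?steps n (\<sigma> ^ 0)"
        using lam_pos[of n] tau[of n] lam_lmax[of "n - 1"] n(1) by (simp add: steps1_def)
      from steps1_has_largest[OF this] ls[of n] have "\<tau> (Suc n) = \<sigma> ^ 0"
        by (metis not_gr_zero)
      with mem1 largest[of n] show "lam n \<le> lam (Suc n)"
        by (simp add: is_largest_def)
    qed (use init L in simp)
  qed (use F g init lam_pos tau y prox_step_variational[OF g(1-3) s lam_pos prox] in auto)
qed

lemma algorithm2_extrapolated_iteration:
  fixes F :: "'a::euclidean_space \<Rightarrow> 'a"
  assumes F: "locally_lipschitz F" "monotone_operator F"
    and g: "proper_fun g" "lsc_fun g" "convex_fun g" "continuous_on (edom g) g"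
    and s: "s \<in> solutions F g"
    and alg: "algorithm2 F g \<alpha> lmax \<sigma> x y lam \<tau>"
  shows "extrapolated_iteration F g \<alpha> (max (lam 0) lmax) x y lam \<tau>"
proof -
  have init: "0 < \<alpha>" "\<alpha> < sqrt 2 - 1" "0 < lmax" "0 < \<sigma>" "\<sigma> < 1" "0 < lam 0" "\<tau> 0 = 1"
    using alg by (auto simp: algorithm2_def initialization_def)
  let ?acc = "\<lambda>n. accept2 F \<alpha> (x (Suc n)) (x n) (y n) (lam n)"
  let ?trial = "\<lambda>n. trial2 lmax \<sigma> (lam n) (\<tau> n)"
  have ls: "\<exists>i. (\<forall>j<i. \<not> ?acc n (?trial n j)) \<and> \<tau> (Suc n) = ?trial n i \<and>
      y (Suc n) = extrapolate (x (Suc n)) (x n) (\<tau> (Suc n)) \<and>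
      lam (Suc n) = \<tau> (Suc n) * lam n \<and> ?acc n (\<tau> (Suc n))" for n
  proof -
    have "linesearch2 F \<alpha> lmax \<sigma> (x (Suc n)) (x n) (y n) (lam n) (\<tau> n) (\<tau> (Suc n)) (y (Suc n)) (lam (Suc n))"
      using alg by (fastforce simp: algorithm2_def dest: spec[of _ "Suc n"])
    then show ?thesis
      by (simp only: linesearch2_def)
  qed
  have y: "y (Suc n) = extrapolate (x (Suc n)) (x n) (\<tau> (Suc n))" for n
    using ls[of n] by blast
  have lam_Suc: "lam (Suc n) = \<tau> (Suc n) * lam n" for n
    using ls[of n] by blast
  have tau: "0 < \<tau> n \<and> \<tau> n \<le> 2" for n
  proof (induction n)
    case (Suc n)
    obtain i where "\<tau> (Suc n) = ?trial n i"
      using ls by blast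
    with trial2_bounds(1,2)[OF init(4,5)] Suc show ?case by simp
  qed (use init in simp)
  have tau_Suc: "(\<tau> (Suc n))\<^sup>2 \<le> 1 + \<tau> n" "lmax / 2 < lam n \<Longrightarrow> \<tau> (Suc n) \<le> 1" for n
  proof -
    obtain i where "\<tau> (Suc n) = ?trial n i"
      using ls by blast
    with trial2_bounds(3,4)[OF init(4,5), of "\<tau> n"] tau[of n]
    show "(\<tau> (Suc n))\<^sup>2 \<le> 1 + \<tau> n" "lmax / 2 < lam n \<Longrightarrow> \<tau> (Suc n) \<le> 1"
      by simp_all
  qed
  have lam_pos: "0 < lam n" for n
    by (induction n) (use init tau in \<open>auto simp: lam_Suc\<close>)
  \<comment> \<open>Above \<open>lmax / 2\<close> the factor is at most 1; otherwise it is at most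
    2, which cannot pass \<open>lmax\<close>.\<close>
  have lam_le: "lam n \<le> max (lam 0) lmax" for n
  proof (induction n)
    case (Suc n)
    show ?case
    proof (cases "lmax / 2 < lam n")
      case True
      then have "lam (Suc n) \<le> 1 * lam n"
        unfolding lam_Suc using tau_Suc(2)[of n] lam_pos[of n] by (intro mult_right_mono) auto
      with Suc show ?thesis by simp
    next
      case False
      then have "lam (Suc n) \<le> 2 * (lmax / 2)"
        unfolding lam_Suc using tau[of "Suc n"] lam_pos[of n] by (intro mult_mono) auto
      then show ?thesis by simp
    qed
  qed simp
  have prox: "x (Suc n) = prox (\<lambda>u. ereal (lam n) * g u) (x n - lam n *\<^sub>R F (y n))" if "0 < n" for n
    using alg that by (simp add: algorithm2_def)
  show ?thesis
  proof
    show "norm (lam (Suc n) *\<^sub>R F (y (Suc n)) - (lam n * \<tau> (Suc n)) *\<^sub>R F (y n))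
            \<le> \<alpha> * norm (y (Suc n) - y n)" for n
    proof -
      have "lam (Suc n) *\<^sub>R F (y (Suc n)) - (lam n * \<tau> (Suc n)) *\<^sub>R F (y n)
          = (\<tau> (Suc n) * lam n) *\<^sub>R (F (y (Suc n)) - F (y n))"
        by (simp add: lam_Suc scaleR_diff_right mult.commute)
      moreover have "?acc n (\<tau> (Suc n))"
        using ls by blast
      ultimately show ?thesis
        using tau[of "Suc n"] lam_pos[of n] by (simp add: accept2_def flip: y)
    qed
    \<comment> \<open>With \<open>lam (Suc n) = \<tau> (Suc n) * lam n\<close>, this is the bound on
      the square of \<open>\<tau> (Suc n)\<close>.\<close>
    show "lam (Suc n) * \<tau> (Suc n) \<le> (1 + \<tau> n) * lam n" for n
      using mult_right_mono[OF tau_Suc(1)[of n], of "lam n"] lam_pos[of n]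
      by (simp add: lam_Suc power2_eq_square mult_ac)
    show "lam (Suc n) * real_of_ereal (g z) = lam n * \<tau> (Suc n) * real_of_ereal (g z)" for n z
      by (simp add: lam_Suc)
    fix L S
    assume L: "L-lipschitz_on S F" "0 < L"
    show "\<exists>c>0. \<forall>n>0. y n \<in> S \<longrightarrow> (\<forall>t\<in>{0..2}. extrapolate (x (Suc n)) (x n) t \<in> S) \<longrightarrow>
            lam n \<le> c \<longrightarrow> lam n \<le> lam (Suc n)"
    \<comment> \<open>The 2 bounds the first trial factor, which is then accepted and, being at
      least 1, does not decrease the step.\<close>
    proof (intro exI[of _ "\<alpha> / (2 * L)"] conjI allI impI)
      fix n :: nat
      assume n: "0 < n" "y n \<in> S" "\<forall>t\<in>{0..2}. extrapolate (x (Suc n)) (x n) t \<in> S" "lam n \<le> \<alpha> / (2 * L)"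
      note bounds = trial2_bounds[OF init(4,5) conjunct1[OF tau[of n]] conjunct2[OF tau[of n]],
          of lmax "lam n"]
      let ?t = "?trial n 0"
      let ?e = "extrapolate (x (Suc n)) (x n) ?t"
      have "?t * lam n * norm (F ?e - F (y n)) \<le> 2 * lam n * (L * norm (?e - y n))"
        using lipschitz_onD[OF L(1), of ?e "y n"] n lam_pos[of n] bounds(1,2)[of 0]
        by (intro mult_mono) (auto simp: dist_norm less_imp_le)
      also have "\<dots> \<le> \<alpha> * norm (?e - y n)"
        using n(4) L(2) mult_right_mono[of "lam n * (2 * L)" \<alpha> "norm (?e - y n)"] by (simp add: field_simps)
      finally have "?acc n ?t"
        by (simp add: accept2_def)
      with ls[of n] have "\<tau> (Suc n) = ?t"
        by (metis not_gr_zero)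
      with bounds(5) show "lam n \<le> lam (Suc n)"
        using lam_pos[of n] by (simp add: lam_Suc)
    qed (use init L in simp)
  qed (use F g init lam_pos lam_le tau y prox_step_variational[OF g(1-3) s lam_pos prox] in auto)
qed

theorem theorem1:
  fixes F :: "'a::euclidean_space \<Rightarrow> 'a"
    and g :: "'a \<Rightarrow> ereal"
    and \<alpha> lmax \<sigma> :: real
    and x y :: "nat \<Rightarrow> 'a"
    and lam \<tau> :: "nat \<Rightarrow> real"
  assumes "locally_lipschitz F"
    and "monotone_operator F"
    and "proper_fun g"
    and "lsc_fun g"
    and "convex_fun g"
    and "continuous_on (edom g) g"
    and "solutions F g \<noteq> {}"
    and "(\<exists>C. C \<noteq> {} \<and> closed C \<and> convex C \<and> g = delta C \<and> algorithm1 F C \<alpha> lmax \<sigma> x y lam \<tau>)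
         \<or> algorithm2 F g \<alpha> lmax \<sigma> x y lam \<tau>"
  shows "\<exists>xs\<in>solutions F g. x \<longlonglongrightarrow> xs \<and> y \<longlonglongrightarrow> xs"
proof -
  obtain s where s: "s \<in> solutions F g"
    using assms(7) by blast
  from assms(8) have "extrapolated_iteration F g \<alpha> (max (lam 0) lmax) x y lam \<tau>"
  proof
    assume "\<exists>C. C \<noteq> {} \<and> closed C \<and> convex C \<and> g = delta C \<and> algorithm1 F C \<alpha> lmax \<sigma> x y lam \<tau>"
    with s assms(1-6) show ?thesis
      using algorithm1_extrapolated_iteration by blast
  next
    assume "algorithm2 F g \<alpha> lmax \<sigma> x y lam \<tau>"
    with s assms(1-6) show ?thesis
      by (intro algorithm2_extrapolated_iteration)
  qed
  from extrapolated_iteration.converges[OF this assms(7)] show ?thesis .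
qed

end
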